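(* Given initial conditions $\gamma(0)\in SPD(n)$ and $\dot\gamma(0)\in T_{\gamma(0)}SPD(n)$, there is $\varepsilon>0$ such that the geodesic equation of $(SPD(n),g_W)$ with these initial conditions has the explicit solution $$\gamma(t)=\gamma(0)+t\,\dot\gamma(0)+t^2\,\Gamma_{\gamma(0)}[\dot\gamma(0)]\,\gamma(0)\,\Gamma_{\gamma(0)}[\dot\gamma(0)],\qquad t\in(-\varepsilon,\varepsilon).$$
   Context: $SPD(n)$ is the set of real symmetric positive-definite $n\times n$ matrices, an open subset of the space $Sym(n)$ of real symmetric matrices, so $T_ASPD(n)\cong Sym(n)$. For $A\in SPD(n)$ and a real $n\times n$ matrix $X$, $\Gamma_A[X]$ denotes the unique real matrix satisfying $A\,\Gamma_A[X]+\Gamma_A[X]\,A=X$. The Wasserstein metric is the Riemannian metric $g_W|_A(X,Y)=\mathrm{tr}(\Gamma_A[Y]\,A\,\Gamma_A[X])=\frac12\mathrm{tr}(\Gamma_A[Y]X)$ for $X,Y\in T_ASPD(n)$. *)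

theory Defs
  imports "HOL-Analysis.Analysis"
begin

section \<open>The Levi-Civita connection and geodesics in a linear chart\<close>

text \<open>
  Let \<open>U\<close> be a relatively open subset of a linear subspace \<open>V\<close> of a normed space, so that every
  tangent space of \<open>U\<close> is \<open>V\<close>, and let \<open>g A u v\<close> be a Riemannian metric on \<open>U\<close>. In this global
  chart every affine connection has the form \<open>(\<nabla>\<^sub>X Y)(A) = DY(A)[X(A)] + C A (X A) (Y A)\<close>, where
  \<open>C A\<close> is bilinear (its coefficients in a basis of \<open>V\<close> are the Christoffel symbols). It is
  torsion-free iff \<open>C A\<close> is symmetric, and metric iff
  \<open>D\<^sub>u (g(v,w)) = g(\<nabla>\<^sub>u v, w) + g(v, \<nabla>\<^sub>u w)\<close> for all constant fields \<open>u\<close>, \<open>v\<close>, \<open>w\<close>.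
\<close>

definition levi_civita_form ::
  "'a::real_normed_vector set \<Rightarrow> 'a set \<Rightarrow> ('a \<Rightarrow> 'a \<Rightarrow> 'a \<Rightarrow> real) \<Rightarrow> ('a \<Rightarrow> 'a \<Rightarrow> 'a \<Rightarrow> 'a) \<Rightarrow> bool" where
  "levi_civita_form V U g C \<longleftrightarrow>
     (\<forall>A\<in>U.
        (\<forall>u\<in>V. \<forall>v\<in>V. C A u v \<in> V) \<and>
        (\<forall>u\<in>V. \<forall>v\<in>V. \<forall>w\<in>V. \<forall>a b. C A (a *\<^sub>R u + b *\<^sub>R v) w = a *\<^sub>R C A u w + b *\<^sub>R C A v w) \<and>
        (\<forall>u\<in>V. \<forall>v\<in>V. C A u v = C A v u) \<and>
        (\<forall>u\<in>V. \<forall>v\<in>V. \<forall>w\<in>V.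
           ((\<lambda>s. g (A + s *\<^sub>R u) v w) has_real_derivative
              g A (C A u v) w + g A v (C A u w)) (at 0)))"

text \<open>
  The form is unique on \<open>V\<close>, so the existential quantifier over \<open>C\<close> in the definition of
  geodesics below refers to the Levi-Civita connection.
\<close>

lemma levi_civita_form_unique:
  assumes C: "levi_civita_form V U g C" and C': "levi_civita_form V U g C'"
    and A: "A \<in> U" and u: "u \<in> V" and v: "v \<in> V"
    and sym: "\<And>x y. x \<in> V \<Longrightarrow> y \<in> V \<Longrightarrow> g A x y = g A y x"
    and nondegenerate: "\<And>x y. x \<in> V \<Longrightarrow> y \<in> V \<Longrightarrow> (\<And>w. w \<in> V \<Longrightarrow> g A x w = g A y w) \<Longrightarrow> x = y"
  shows "C A u v = C' A u v"
proof (rule nondegenerate)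
  show "C A u v \<in> V" "C' A u v \<in> V"
    using C C' A u v unfolding levi_civita_form_def by simp_all
next
  fix w assume w: "w \<in> V"
  have in_V: "C A x y \<in> V" "C' A x y \<in> V" if "x \<in> V" "y \<in> V" for x y
    using C C' A that unfolding levi_civita_form_def by simp_all
  have comm: "C A x y = C A y x" "C' A x y = C' A y x" if "x \<in> V" "y \<in> V" for x y
    using C C' A that unfolding levi_civita_form_def by simp_all
  have D: "g A (C A x y) z + g A y (C A x z) = g A (C' A x y) z + g A y (C' A x z)"
    if xyz: "x \<in> V" "y \<in> V" "z \<in> V" for x y z
  proof (rule DERIV_unique)
    show "((\<lambda>s. g (A + s *\<^sub>R x) y z) has_real_derivative g A (C A x y) z + g A y (C A x z)) (at 0)"
      using C A xyz unfolding levi_civita_form_def by simp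
    show "((\<lambda>s. g (A + s *\<^sub>R x) y z) has_real_derivative g A (C' A x y) z + g A y (C' A x z)) (at 0)"
      using C' A xyz unfolding levi_civita_form_def by simp
  qed
  have "g A (C A w u) v = g A v (C A u w)" "g A (C' A w u) v = g A v (C' A u w)"
    and "g A u (C A w v) = g A u (C A v w)" "g A u (C' A w v) = g A u (C' A v w)"
    and "C A v u = C A u v" "C' A v u = C' A u v"
    using u v w by (metis sym in_V comm)+
  then show "g A (C A u v) w = g A (C' A u v) w"
    using D[OF u v w] D[OF v u w] D[OF w u v] by simp
qed

text \<open>The geodesic equation \<open>\<nabla>\<^bsub>\<gamma>'\<^esub> \<gamma>' = \<gamma>'' + C(\<gamma>)(\<gamma>', \<gamma>') = 0\<close> on an open set of times \<open>T\<close>.\<close>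

definition geodesic_on ::
  "'a::real_normed_vector set \<Rightarrow> 'a set \<Rightarrow> ('a \<Rightarrow> 'a \<Rightarrow> 'a \<Rightarrow> real) \<Rightarrow> real set \<Rightarrow> (real \<Rightarrow> 'a) \<Rightarrow> bool" where
  "geodesic_on V U g T \<gamma> \<longleftrightarrow>
     (\<forall>t\<in>T. \<gamma> t \<in> U) \<and>
     (\<exists>C. levi_civita_form V U g C \<and>
       (\<exists>\<gamma>' \<gamma>''. \<forall>t\<in>T.
          (\<gamma> has_vector_derivative \<gamma>' t) (at t) \<and>
          (\<gamma>' has_vector_derivative \<gamma>'' t) (at t) \<and>
          \<gamma>'' t + C (\<gamma> t) (\<gamma>' t) (\<gamma>' t) = 0))"

section \<open>The Wasserstein metric on positive-definite matrices\<close>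

definition Sym :: "(real ^ 'n ^ 'n) set" where
  "Sym = {X. transpose X = X}"

definition SPD :: "(real ^ 'n ^ 'n) set" where
  "SPD = {A \<in> Sym. \<forall>x. x \<noteq> 0 \<longrightarrow> x \<bullet> (A *v x) > 0}"

definition sylvester :: "real ^ 'n ^ 'n \<Rightarrow> real ^ 'n ^ 'n \<Rightarrow> real ^ 'n ^ 'n" where
  "sylvester A X = (THE G. A ** G + G ** A = X)"

definition wasserstein :: "real ^ 'n ^ 'n \<Rightarrow> real ^ 'n ^ 'n \<Rightarrow> real ^ 'n ^ 'n \<Rightarrow> real" where
  "wasserstein A X Y = trace (sylvester A Y ** A ** sylvester A X)"

end

(* The Levi-Civita connection of the Wasserstein metric, written with G = sylvester A, is
   C A u v = - (G u ** A ** G v + G v ** A ** G u), which the Koszul formula yields once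
   g A v w = tr (G w ** v) / 2 is used, since sylvester is self-adjoint for the trace form and
   D_u (G v) = - G (u ** G v + G v ** u).
   With G = sylvester A X the proposed curve is (1 + t G) ** A ** (1 + t G). For small t the
   matrix 1 + t G is invertible, so the curve stays in SPD, and its velocity satisfies
   sylvester (gamma t) (gamma' t) = G ** inverse (1 + t G). Hence C (gamma t) (gamma' t) (gamma' t)
   equals - 2 G ** A ** G, the negative of the constant acceleration. *)

theory Submission
  imports Defs
begin

section \<open>Matrix multiplication and trace\<close>

lemma bounded_bilinear_matrix_mult:
  "bounded_bilinear ((**) :: real^'n^'m \<Rightarrow> real^'p^'n \<Rightarrow> real^'p^'m)"
  unfolding bilinear_conv_bounded_bilinear[symmetric] bilinear_def
  by (auto intro!: linearI simp: matrix_add_ldistrib matrix_matrix_mult_def vec_eq_iff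
      sum.distrib sum_distrib_left algebra_simps)

lemmas matrix_mult_distribs =
  bounded_bilinear.add_left[OF bounded_bilinear_matrix_mult]
  bounded_bilinear.add_right[OF bounded_bilinear_matrix_mult]
  bounded_bilinear.diff_left[OF bounded_bilinear_matrix_mult]
  bounded_bilinear.diff_right[OF bounded_bilinear_matrix_mult]
  bounded_bilinear.minus_left[OF bounded_bilinear_matrix_mult]
  bounded_bilinear.minus_right[OF bounded_bilinear_matrix_mult]
  bounded_bilinear.scaleR_left[OF bounded_bilinear_matrix_mult]
  bounded_bilinear.scaleR_right[OF bounded_bilinear_matrix_mult]

lemma transpose_add: "transpose (A + B) = transpose A + transpose B"
  by (simp add: transpose_def vec_eq_iff)

lemma transpose_minus: "transpose (- A) = - transpose A"
  by (simp add: transpose_def vec_eq_iff)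

lemma trace_minus: "trace (- A) = - trace (A :: real^'n^'n)"
  by (simp add: trace_def sum_negf)

lemma trace_transpose: "trace (transpose A) = trace A"
  by (simp add: trace_def transpose_def)

lemma bounded_linear_trace: "bounded_linear (trace :: real^'n^'n \<Rightarrow> real)"
  unfolding linear_conv_bounded_linear[symmetric]
  by (auto intro!: linearI simp: trace_def sum.distrib sum_distrib_left)

text \<open>Brings positivity of the quadratic form of \<open>A\<close> to bear on matrices, one
  column at a time.\<close>

lemma trace_transpose_sandwich:
  fixes A G :: "real^'n^'n"
  shows "trace (transpose G ** (A ** G)) = (\<Sum>j\<in>UNIV. column j G \<bullet> (A *v column j G))"
  by (simp add: trace_def matrix_matrix_mult_def transpose_def column_def
      matrix_vector_mult_def inner_vec_def)

section \<open>The Sylvester equation\<close>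

text \<open>Where this linear map is injective, \<open>sylvester A\<close> is its inverse, so the
  \<open>THE\<close> can be handled by linear algebra.\<close>

definition lyapunov :: "real^'n^'n \<Rightarrow> real^'n^'n \<Rightarrow> real^'n^'n" where
  "lyapunov A G = A ** G + G ** A"

lemma linear_lyapunov: "linear (lyapunov A)"
  by (intro linearI) (simp_all add: lyapunov_def matrix_mult_distribs algebra_simps)

lemma lyapunov_add_scaleR: "lyapunov (A + s *\<^sub>R u) G = lyapunov A G + s *\<^sub>R lyapunov u G"
  by (simp add: lyapunov_def matrix_mult_distribs algebra_simps)

text \<open>Pairing A G + G A = 0 with G in the trace form gives tr(G^T A G) + tr(G A G^T) = 0. Both
  terms are sums of values of the quadratic form of \<open>A\<close>, hence nonnegative, so every
  column of G vanishes.\<close>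

lemma inj_lyapunov:
  fixes A :: "real^'n^'n"
  assumes "A \<in> SPD"
  shows "inj (lyapunov A)"
proof -
  have "G = 0" if G: "lyapunov A G = 0" for G
  proof -
    have pos: "x \<bullet> (A *v x) > 0" if "x \<noteq> 0" for x
      using assms that by (simp add: SPD_def)
    have nonneg: "x \<bullet> (A *v x) \<ge> 0" for x
      using pos[of x] by (cases "x = 0") auto
    have "transpose G ** (A ** G) + transpose G ** (G ** A) = 0"
      using arg_cong[OF G, of "\<lambda>Y. transpose G ** Y"]
      by (simp add: lyapunov_def matrix_mult_distribs)
    then have "trace (transpose G ** (A ** G)) + trace (transpose G ** (G ** A)) = 0"
      by (metis trace_add trace_0 mat_0)
    \<comment> \<open>Cyclicity turns the second term into the same sandwich, now around the
      transpose of G.\<close>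
    moreover have "trace (transpose G ** (G ** A)) =
        trace (transpose (transpose G) ** (A ** transpose G))"
      by (metis trace_mul_sym matrix_mul_assoc transpose_transpose)
    ultimately have "(\<Sum>j\<in>UNIV. column j G \<bullet> (A *v column j G)) +
        (\<Sum>j\<in>UNIV. column j (transpose G) \<bullet> (A *v column j (transpose G))) = 0"
      by (simp only: trace_transpose_sandwich)
    then have "(\<Sum>j\<in>UNIV. column j G \<bullet> (A *v column j G)) = 0"
      by (smt (verit) nonneg sum_nonneg)
    then have "column j G = 0" for j
      using pos[of "column j G"] nonneg by (subst (asm) sum_nonneg_eq_0_iff) force+
    then show "G = 0"
      by (simp add: column_def vec_eq_iff)
  qed
  then show ?thesis
    by (simp add: linear_injective_0[OF linear_lyapunov])
qed

lemma sylvester_unique: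
  assumes "inj (lyapunov A)" "lyapunov A G = X"
  shows "sylvester A X = G"
  unfolding sylvester_def lyapunov_def[symmetric] using assms by (blast dest: injD)

text \<open>Existence comes for free: an injective linear endomorphism of a finite-dimensional space
  is surjective.\<close>

lemma lyapunov_sylvester:
  assumes "inj (lyapunov A)"
  shows "lyapunov A (sylvester A X) = X"
  using linear_injective_imp_surjective[OF linear_lyapunov assms] sylvester_unique[OF assms]
  by (metis surjD)

lemma linear_sylvester:
  assumes "inj (lyapunov A)"
  shows "linear (sylvester A)"
  by (intro linearI sylvester_unique[OF assms])
    (simp_all add: linear_add[OF linear_lyapunov] linear_cmul[OF linear_lyapunov]
      lyapunov_sylvester[OF assms])

text \<open>Transposing the equation shows that the transposed solution solves it too, and solutions
  are unique.\<close>

lemma sylvester_in_Sym: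
  assumes inj: "inj (lyapunov A)" and "A \<in> Sym" "X \<in> Sym"
  shows "sylvester A X \<in> Sym"
proof -
  have "lyapunov A (transpose (sylvester A X)) = transpose (lyapunov A (sylvester A X))"
    using assms by (simp add: Sym_def lyapunov_def transpose_add matrix_transpose_mul add.commute)
  also have "\<dots> = X"
    using assms by (simp add: lyapunov_sylvester Sym_def)
  finally have "sylvester A X = transpose (sylvester A X)"
    by (rule sylvester_unique[OF inj])
  then show ?thesis
    by (simp add: Sym_def)
qed

text \<open>Self-adjointness for the trace form, by cyclicity; the inverse
  \<open>sylvester A\<close> inherits it.\<close>

lemma trace_lyapunov_commute: "trace (lyapunov A V ** W) = trace (V ** lyapunov A W)"
  by (simp add: lyapunov_def matrix_mult_distribs trace_add)
    (metis trace_mul_sym matrix_mul_assoc add.commute)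

lemma trace_sylvester_commute:
  assumes "inj (lyapunov A)"
  shows "trace (sylvester A v ** w) = trace (v ** sylvester A w)"
  by (metis trace_lyapunov_commute lyapunov_sylvester[OF assms])

text \<open>For symmetric factors, transposition reverses the product, so tr(W V A) = tr(W A V) and
  the two terms of tr(W (A V + V A)) agree. In the new form the base point enters only through one
  \<open>sylvester\<close>, linearly, which makes the metric easy to differentiate.\<close>

lemma wasserstein_eq_half_trace:
  assumes inj: "inj (lyapunov A)" and "A \<in> Sym" "v \<in> Sym" "w \<in> Sym"
  shows "wasserstein A v w = trace (sylvester A w ** v) / 2"
proof -
  define V W where "V = sylvester A v" and "W = sylvester A w"
  have sym: "transpose A = A" "transpose V = V" "transpose W = W"
    using assms sylvester_in_Sym[OF inj] by (auto simp: V_def W_def Sym_def)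
  have "trace (W ** V ** A) = trace (transpose (W ** V ** A))"
    by (simp add: trace_transpose)
  also have "\<dots> = trace (A ** V ** W)"
    by (simp add: matrix_transpose_mul sym matrix_mul_assoc)
  also have "\<dots> = trace (W ** A ** V)"
    by (metis trace_mul_sym matrix_mul_assoc)
  finally have "trace (W ** lyapunov A V) = 2 * trace (W ** A ** V)"
    by (simp add: lyapunov_def matrix_mult_distribs trace_add matrix_mul_assoc)
  then show ?thesis
    by (simp add: V_def W_def lyapunov_sylvester[OF inj] wasserstein_def)
qed

section \<open>The derivative of the solution of the Sylvester equation\<close>

text \<open>If \<open>lyapunov A\<close> is bounded below by B and \<open>lyapunov u\<close> is
  bounded by M, a perturbation with |s| < B / (2 M) costs at most half of B. The resulting bound is
  uniform in s, and so controls the inverses uniformly.\<close>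

lemma eventually_lyapunov_bounded_below:
  fixes A u :: "real^'n^'n"
  assumes "inj (lyapunov A)"
  obtains B where "B > 0"
    "\<forall>\<^sub>F s in nhds 0. \<forall>G. B * norm G \<le> norm (lyapunov (A + s *\<^sub>R u) G)"
proof -
  obtain B where B: "B > 0" "\<And>G. B * norm G \<le> norm (lyapunov A G)"
    using linear_inj_bounded_below_pos[OF linear_lyapunov assms] by blast
  obtain M where M: "M > 0" "\<And>G. norm (lyapunov u G) \<le> M * norm G"
    using linear_bounded_pos[OF linear_lyapunov] by blast
  have "B / 2 * norm G \<le> norm (lyapunov (A + s *\<^sub>R u) G)" if s: "\<bar>s\<bar> < B / (2 * M)" for s G
  proof -
    have "\<bar>s\<bar> * M \<le> B / 2"
      using s M(1) by (simp add: field_simps)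
    then have "\<bar>s\<bar> * (M * norm G) \<le> B / 2 * norm G"
      by (metis mult.assoc mult_right_mono norm_ge_zero)
    then have "norm (s *\<^sub>R lyapunov u G) \<le> B / 2 * norm G"
      using mult_left_mono[OF M(2)[of G], of "\<bar>s\<bar>"] by simp
    then show ?thesis
      using B(2)[of G] norm_diff_ineq[of "lyapunov A G" "s *\<^sub>R lyapunov u G"]
      by (simp add: lyapunov_add_scaleR)
  qed
  moreover have "\<forall>\<^sub>F s in nhds 0. \<bar>s\<bar> < B / (2 * M)"
    using B(1) M(1) by (intro eventually_nhds_metric[THEN iffD2] exI[of _ "B / (2 * M)"]) auto
  ultimately have "\<forall>\<^sub>F s in nhds 0. \<forall>G. B / 2 * norm G \<le> norm (lyapunov (A + s *\<^sub>R u) G)"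
    by (elim eventually_mono) blast
  then show ?thesis
    using that[of "B / 2"] B(1) by simp
qed

lemma eventually_inj_lyapunov:
  assumes "inj (lyapunov A)"
  shows "\<forall>\<^sub>F s in nhds 0. inj (lyapunov (A + s *\<^sub>R u))"
proof -
  obtain B where "B > 0"
    and B: "\<forall>\<^sub>F s in nhds 0. \<forall>G. B * norm G \<le> norm (lyapunov (A + s *\<^sub>R u) G)"
    using eventually_lyapunov_bounded_below[OF assms] by blast
  show ?thesis
    using B
  proof eventually_elim
    case (elim s)
    then have "norm G \<le> 0" if "lyapunov (A + s *\<^sub>R u) G = 0" for G
      using \<open>B > 0\<close> that by (metis norm_zero mult_le_0_iff not_less)
    then show ?case
      by (simp add: linear_injective_0[OF linear_lyapunov])
  qed
qed

text \<open>A resolvent identity: \<open>lyapunov (A + s *\<^sub>R u)\<close> sends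
  \<open>sylvester A v\<close> to v plus s times \<open>lyapunov u (sylvester A v)\<close>, and
  \<open>?D\<close> subtracts the correction. It is exact, so the difference quotient has no
  remainder to estimate.\<close>

lemma sylvester_add_scaleR:
  assumes "inj (lyapunov A)" "inj (lyapunov (A + s *\<^sub>R u))"
  shows "sylvester (A + s *\<^sub>R u) v - sylvester A v =
    s *\<^sub>R (- sylvester (A + s *\<^sub>R u) (lyapunov u (sylvester A v)))"
proof -
  let ?D = "sylvester A v - s *\<^sub>R sylvester (A + s *\<^sub>R u) (lyapunov u (sylvester A v))"
  have "lyapunov (A + s *\<^sub>R u) ?D = v"
    by (simp add: linear_diff[OF linear_lyapunov] linear_cmul[OF linear_lyapunov]
        lyapunov_sylvester[OF assms(2)])
      (simp add: lyapunov_add_scaleR lyapunov_sylvester[OF assms(1)])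
  then have "sylvester (A + s *\<^sub>R u) v = ?D"
    by (rule sylvester_unique[OF assms(2)])
  then show ?thesis
    by simp
qed

text \<open>The resolvent identity together with the uniform lower bound gives an estimate of order
  |s|.\<close>

lemma sylvester_tendsto:
  assumes inj: "inj (lyapunov A)"
  shows "((\<lambda>s. sylvester (A + s *\<^sub>R u) v) \<longlongrightarrow> sylvester A v) (nhds 0)"
proof -
  obtain B where "B > 0"
    and B: "\<forall>\<^sub>F s in nhds 0. \<forall>G. B * norm G \<le> norm (lyapunov (A + s *\<^sub>R u) G)"
    using eventually_lyapunov_bounded_below[OF inj] by blast
  define Z where "Z = lyapunov u (sylvester A v)"
  have "\<forall>\<^sub>F s in nhds 0. norm (sylvester (A + s *\<^sub>R u) v - sylvester A v) \<le> \<bar>s\<bar> * (norm Z / B)"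
    using B eventually_inj_lyapunov[OF inj, of u]
  proof eventually_elim
    case (elim s)
    have "B * norm (sylvester (A + s *\<^sub>R u) Z) \<le> norm Z"
      using elim(1) lyapunov_sylvester[OF elim(2)] by metis
    then have "norm (sylvester (A + s *\<^sub>R u) Z) \<le> norm Z / B"
      using \<open>B > 0\<close> by (simp add: field_simps)
    then show ?case
      by (simp add: sylvester_add_scaleR[OF inj elim(2)] Z_def[symmetric] mult_left_mono
          del: times_divide_eq_right)
  qed
  moreover have "((\<lambda>s. \<bar>s\<bar> * (norm Z / B)) \<longlongrightarrow> 0) (nhds 0)"
    by (rule tendsto_eq_intros refl tendsto_ident_at filterlim_ident | simp)+
  ultimately show ?thesis
    by (rule Lim_null[THEN iffD2, OF Lim_null_comparison])
qed

lemma has_vector_derivative_difference_quotient: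
  fixes f :: "real \<Rightarrow> 'a::real_normed_vector"
  assumes "((\<lambda>s. (f (x + s) - f x) /\<^sub>R s) \<longlongrightarrow> D) (at 0)"
  shows "(f has_vector_derivative D) (at x)"
proof -
  have "((\<lambda>s. norm ((f (x + s) - f x) /\<^sub>R s - D)) \<longlongrightarrow> 0) (at 0)"
    using assms by (simp add: tendsto_norm_zero_iff LIM_zero_iff)
  moreover have "\<forall>\<^sub>F s in at 0. norm ((f (x + s) - f x) /\<^sub>R s - D) =
      norm (f (x + s) - f x - s *\<^sub>R D) / norm s"
  proof (rule eventually_at_filter[THEN iffD2, OF always_eventually], intro allI impI)
    fix s :: real assume "s \<noteq> 0"
    then have "(f (x + s) - f x) /\<^sub>R s - D = (f (x + s) - f x - s *\<^sub>R D) /\<^sub>R s"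
      by (simp add: scaleR_diff_right)
    then show "norm ((f (x + s) - f x) /\<^sub>R s - D) = norm (f (x + s) - f x - s *\<^sub>R D) / norm s"
      by (simp add: divide_inverse_commute)
  qed
  ultimately show ?thesis
    unfolding has_vector_derivative_def has_derivative_at
    by (auto intro: bounded_linear_scaleR_left elim: Lim_transform_eventually)
qed

text \<open>By the resolvent identity the difference quotient is
  \<open>- sylvester (A + s *\<^sub>R u) Z\<close>, so continuity alone yields the limit.\<close>

lemma sylvester_has_vector_derivative:
  assumes inj: "inj (lyapunov A)"
  shows "((\<lambda>s. sylvester (A + s *\<^sub>R u) v) has_vector_derivative
    - sylvester A (lyapunov u (sylvester A v))) (at 0)"
proof -
  define Z where "Z = lyapunov u (sylvester A v)"
  have "((\<lambda>s. - sylvester (A + s *\<^sub>R u) Z) \<longlongrightarrow> - sylvester A Z) (at 0)"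
    by (intro tendsto_minus tendsto_mono[OF _ sylvester_tendsto[OF inj]]) (simp add: at_within_def)
  moreover have "\<forall>\<^sub>F s in at 0. - sylvester (A + s *\<^sub>R u) Z =
      (sylvester (A + s *\<^sub>R u) v - sylvester A v) /\<^sub>R s"
    using eventually_inj_lyapunov[OF inj, of u] unfolding eventually_at_filter
    by eventually_elim (simp add: sylvester_add_scaleR[OF inj] Z_def)
  ultimately have "((\<lambda>s. (sylvester (A + s *\<^sub>R u) v - sylvester A v) /\<^sub>R s)
      \<longlongrightarrow> - sylvester A Z) (at 0)"
    by (rule Lim_transform_eventually)
  then show ?thesis
    by (intro has_vector_derivative_difference_quotient) (simp add: Z_def)
qed

section \<open>The Levi-Civita connection\<close>

definition wasserstein_christoffel ::
  "real^'n^'n \<Rightarrow> real^'n^'n \<Rightarrow> real^'n^'n \<Rightarrow> real^'n^'n" where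
  "wasserstein_christoffel A u v =
     - (sylvester A u ** A ** sylvester A v + sylvester A v ** A ** sylvester A u)"

lemma SPD_imp_Sym: "A \<in> SPD \<Longrightarrow> A \<in> Sym"
  by (simp add: SPD_def)

lemma wasserstein_christoffel_in_Sym:
  assumes "A \<in> SPD" "u \<in> Sym" "v \<in> Sym"
  shows "wasserstein_christoffel A u v \<in> Sym"
proof -
  note Sym = sylvester_in_Sym[OF inj_lyapunov[OF assms(1)] SPD_imp_Sym[OF assms(1)]]
  show ?thesis
    using Sym[OF assms(2)] Sym[OF assms(3)] SPD_imp_Sym[OF assms(1)]
    by (simp add: wasserstein_christoffel_def Sym_def transpose_minus transpose_add
        matrix_transpose_mul matrix_mul_assoc add.commute del: minus_add_distrib)
qed

text \<open>The algebraic core of metric compatibility. Substituting u = A U + U A on the right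
  yields four words in U, V, W, A; they are cyclic rotations of the four words on the left.\<close>

lemma trace_wasserstein_christoffel:
  assumes "inj (lyapunov A)"
  shows "trace (sylvester A w ** wasserstein_christoffel A u v) +
      trace (sylvester A v ** wasserstein_christoffel A u w) =
    - trace (lyapunov u (sylvester A w) ** sylvester A v)"
proof -
  define U V W where "U = sylvester A u" and "V = sylvester A v" and "W = sylvester A w"
  have u: "u = A ** U + U ** A"
    using lyapunov_sylvester[OF assms, of u] by (simp add: lyapunov_def U_def)
  have "trace (W ** V ** A ** U) = trace (A ** U ** W ** V)"
    "trace (V ** U ** A ** W) = trace (U ** A ** W ** V)"
    "trace (V ** W ** A ** U) = trace (W ** A ** U ** V)"
    by (metis trace_mul_sym matrix_mul_assoc)+
  moreover have "lyapunov u W ** V =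
      A ** U ** W ** V + U ** A ** W ** V + W ** A ** U ** V + W ** U ** A ** V"
    unfolding lyapunov_def u by (simp add: matrix_mult_distribs matrix_mul_assoc)
  ultimately show ?thesis
    by (simp add: wasserstein_christoffel_def matrix_mult_distribs matrix_mul_assoc
        trace_add trace_minus trace_sub flip: U_def V_def W_def)
qed

lemma wasserstein_has_real_derivative:
  assumes A: "A \<in> SPD" and Sym: "u \<in> Sym" "v \<in> Sym" "w \<in> Sym"
  shows "((\<lambda>s. wasserstein (A + s *\<^sub>R u) v w) has_real_derivative
    wasserstein A (wasserstein_christoffel A u v) w +
    wasserstein A v (wasserstein_christoffel A u w)) (at 0)"
proof -
  note inj = inj_lyapunov[OF A] and ASym = SPD_imp_Sym[OF A]
  have bl: "bounded_linear (\<lambda>G. trace (G ** v) / 2)"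
    using bounded_linear_compose[OF bounded_linear_trace
        bounded_bilinear.bounded_linear_left[OF bounded_bilinear_matrix_mult]]
    by (intro bounded_linear_divide[THEN bounded_linear_compose])
  \<comment> \<open>Self-adjointness moves \<open>sylvester\<close> off the Christoffel term in the
    second summand and onto v.\<close>
  have "wasserstein A (wasserstein_christoffel A u v) w +
      wasserstein A v (wasserstein_christoffel A u w) =
    (trace (sylvester A w ** wasserstein_christoffel A u v) +
      trace (sylvester A v ** wasserstein_christoffel A u w)) / 2"
    using trace_sylvester_commute[OF inj, of "wasserstein_christoffel A u w" v]
      trace_mul_sym[of "wasserstein_christoffel A u w" "sylvester A v"]
      trace_mul_sym[of "sylvester A w" v]
    by (simp add: wasserstein_eq_half_trace[OF inj ASym] Sym
        wasserstein_christoffel_in_Sym[OF A] add_divide_distrib)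
  also have "\<dots> = - trace (lyapunov u (sylvester A w) ** sylvester A v) / 2"
    by (simp only: trace_wasserstein_christoffel[OF inj])
  \<comment> \<open>Self-adjointness again, now producing the derivative of \<open>sylvester\<close>
    computed above.\<close>
  also have "\<dots> = trace (- sylvester A (lyapunov u (sylvester A w)) ** v) / 2"
    by (simp add: trace_sylvester_commute[OF inj] matrix_mult_distribs trace_minus)
  finally have eq: "wasserstein A (wasserstein_christoffel A u v) w +
      wasserstein A v (wasserstein_christoffel A u w) =
    trace (- sylvester A (lyapunov u (sylvester A w)) ** v) / 2" .
  \<comment> \<open>The half-trace formula needs only symmetry and injectivity of
    \<open>lyapunov\<close>, and both persist near s = 0.\<close>
  have ev: "\<forall>\<^sub>F s in nhds 0. wasserstein (A + s *\<^sub>R u) v w =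
      trace (sylvester (A + s *\<^sub>R u) w ** v) / 2"
    using eventually_inj_lyapunov[OF inj, of u]
  proof eventually_elim
    case (elim s)
    have "A + s *\<^sub>R u \<in> Sym"
      using ASym Sym by (simp add: Sym_def transpose_add transpose_scalar)
    then show ?case
      by (rule wasserstein_eq_half_trace[OF elim _ Sym(2,3)])
  qed
  have "((\<lambda>s. trace (sylvester (A + s *\<^sub>R u) w ** v) / 2) has_real_derivative
      trace (- sylvester A (lyapunov u (sylvester A w)) ** v) / 2) (at 0)"
    using bounded_linear.has_vector_derivative[OF bl sylvester_has_vector_derivative[OF inj]]
    by (simp add: has_real_derivative_iff_has_vector_derivative)
  then show ?thesis
    by (simp add: eq DERIV_cong_ev[OF refl ev refl])
qed

lemma levi_civita_form_wasserstein:
  "levi_civita_form Sym SPD wasserstein wasserstein_christoffel"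
  unfolding levi_civita_form_def
proof (intro ballI conjI allI)
  fix A u v w :: "real^'n^'n" and a b :: real
  assume A: "A \<in> SPD"
  show "wasserstein_christoffel A (a *\<^sub>R u + b *\<^sub>R v) w =
      a *\<^sub>R wasserstein_christoffel A u w + b *\<^sub>R wasserstein_christoffel A v w"
    using linear_sylvester[OF inj_lyapunov[OF A]]
    by (simp add: wasserstein_christoffel_def linear_add linear_cmul matrix_mult_distribs
        algebra_simps)
qed (simp_all add: wasserstein_christoffel_in_Sym wasserstein_has_real_derivative,
    simp add: wasserstein_christoffel_def add.commute)

section \<open>The geodesic\<close>

text \<open>A kernel vector x satisfies x = - t G x, which is impossible for nonzero x when |t| M <
  1, where M bounds the operator norm of G.\<close>

lemma mat_1_add_scaleR_invertible:
  fixes G :: "real^'n^'n"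
  shows "\<exists>\<epsilon>>0. \<forall>t. \<bar>t\<bar> < \<epsilon> \<longrightarrow> invertible (mat 1 + t *\<^sub>R G)"
proof -
  obtain M where M: "M > 0" "\<And>x. norm (G *v x) \<le> M * norm x"
    using linear_bounded_pos[OF matrix_vector_mul_linear] by blast
  have "x = 0" if t: "\<bar>t\<bar> < 1 / M" and x: "(mat 1 + t *\<^sub>R G) *v x = 0" for t x
  proof (rule ccontr)
    assume "x \<noteq> 0"
    have "x = - (t *\<^sub>R (G *v x))"
      using x by (simp add: matrix_vector_mult_add_rdistrib scaleR_matrix_vector_assoc
          eq_neg_iff_add_eq_0)
    then have "norm x = \<bar>t\<bar> * norm (G *v x)"
      by (metis norm_minus_cancel norm_scaleR)
    also have "\<dots> \<le> \<bar>t\<bar> * M * norm x"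
      using mult_left_mono[OF M(2)[of x], of "\<bar>t\<bar>"] by simp
    also have "\<dots> < norm x"
      using t M(1) \<open>x \<noteq> 0\<close> by (simp add: field_simps)
    finally show False by simp
  qed
  then show ?thesis
    using M(1) by (intro exI[of _ "1 / M"])
      (auto simp: invertible_left_inverse matrix_left_invertible_ker)
qed

text \<open>The quadratic form at x is that of \<open>A\<close> at P x, and P x is nonzero because P
  is injective.\<close>

lemma SPD_congruence:
  fixes A P :: "real^'n^'n"
  assumes A: "A \<in> SPD" and P: "invertible P"
  shows "transpose P ** A ** P \<in> SPD"
proof -
  have "x \<bullet> ((transpose P ** A ** P) *v x) > 0" if "x \<noteq> 0" for x
  proof -
    have "P *v x \<noteq> 0"
      using P that unfolding invertible_left_inverse matrix_left_invertible_ker by blast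
    then have "(P *v x) \<bullet> (A *v (P *v x)) > 0"
      using A by (simp add: SPD_def)
    then show ?thesis
      by (metis dot_lmul_matrix vector_transpose_matrix matrix_vector_mul_assoc)
  qed
  then show ?thesis
    using SPD_imp_Sym[OF A]
    by (simp add: SPD_def Sym_def matrix_transpose_mul matrix_mul_assoc)
qed

theorem corollary3p6:
  fixes A X :: "real ^ 'n ^ 'n" and \<gamma> :: "real \<Rightarrow> real ^ 'n ^ 'n"
  assumes "A \<in> SPD" and "X \<in> Sym"
    and "\<And>t. \<gamma> t = A + t *\<^sub>R X + t\<^sup>2 *\<^sub>R (sylvester A X ** A ** sylvester A X)"
  shows "\<exists>\<epsilon>>0. geodesic_on Sym SPD wasserstein {-\<epsilon><..<\<epsilon>} \<gamma> \<and>
           \<gamma> 0 = A \<and> (\<gamma> has_vector_derivative X) (at 0)"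
proof -
  define G where "G = sylvester A X"
  define P where "P t = mat 1 + t *\<^sub>R G" for t
  define \<gamma>' where "\<gamma>' t = X + (2 * t) *\<^sub>R (G ** A ** G)" for t
  define \<gamma>'' where "\<gamma>'' = 2 *\<^sub>R (G ** A ** G)"
  note inj = inj_lyapunov[OF assms(1)]
  have \<gamma>: "\<gamma> t = A + t *\<^sub>R X + t\<^sup>2 *\<^sub>R (G ** A ** G)" for t
    by (simp add: assms(3) G_def)
  have X: "X = A ** G + G ** A"
    using lyapunov_sylvester[OF inj, of X] by (simp add: lyapunov_def G_def)
  have "G \<in> Sym"
    using sylvester_in_Sym[OF inj SPD_imp_Sym] assms by (simp add: G_def)
  then have P_sym: "transpose (P t) = P t" for t
    by (simp add: P_def Sym_def transpose_add transpose_scalar transpose_mat)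
  have \<gamma>_eq: "\<gamma> t = P t ** A ** P t" for t
    by (simp add: \<gamma> X P_def matrix_mult_distribs matrix_mul_assoc power2_eq_square algebra_simps)
  \<comment> \<open>The shape given by the product rule for P A P with P' = G; it lets the Sylvester
    equation at \<open>\<gamma> t\<close> be solved by inspection.\<close>
  have \<gamma>'_eq: "\<gamma>' t = G ** A ** P t + P t ** A ** G" for t
    by (simp add: \<gamma>'_def X P_def matrix_mult_distribs matrix_mul_assoc algebra_simps
        flip: scaleR_add_left)
  have deriv: "(\<gamma> has_vector_derivative \<gamma>' t) (at t)" for t
    unfolding \<gamma>[abs_def] \<gamma>'_def
    by (auto intro!: derivative_eq_intros simp: has_vector_derivative_def algebra_simps)
  have deriv': "(\<gamma>' has_vector_derivative \<gamma>'') (at t)" for t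
    unfolding \<gamma>'_def[abs_def] \<gamma>''_def
    by (auto intro!: derivative_eq_intros)
  obtain \<epsilon> where "\<epsilon> > 0" and \<epsilon>: "\<And>t. \<bar>t\<bar> < \<epsilon> \<Longrightarrow> invertible (P t)"
    using mat_1_add_scaleR_invertible[of G] unfolding P_def by blast
  have SPD: "\<gamma> t \<in> SPD" if "\<bar>t\<bar> < \<epsilon>" for t
    using SPD_congruence[OF assms(1) \<epsilon>[OF that]] by (simp add: \<gamma>_eq P_sym)
  have geodesic: "\<gamma>'' + wasserstein_christoffel (\<gamma> t) (\<gamma>' t) (\<gamma>' t) = 0" if t: "\<bar>t\<bar> < \<epsilon>" for t
  proof -
    obtain Q where Q: "P t ** Q = mat 1" "Q ** P t = mat 1"
      using \<epsilon>[OF t] by (auto simp: invertible_def)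
    \<comment> \<open>\<open>P t\<close> is a polynomial in G, so it commutes with G, and hence so
      does its inverse Q.\<close>
    have PG: "P t ** G = G ** P t"
      by (simp add: P_def matrix_mult_distribs)
    have QG: "Q ** G = G ** Q"
      by (metis PG Q matrix_mul_assoc matrix_mul_lid matrix_mul_rid)
    have K1: "\<gamma> t ** (G ** Q) = P t ** A ** G"
      by (metis \<gamma>_eq Q(1) QG matrix_mul_assoc matrix_mul_rid)
    have K2: "G ** Q ** \<gamma> t = G ** A ** P t"
      by (metis \<gamma>_eq Q(2) matrix_mul_assoc matrix_mul_rid)
    have "lyapunov (\<gamma> t) (G ** Q) = \<gamma>' t"
      by (simp add: lyapunov_def K1 K2 \<gamma>'_eq add.commute)
    then have "sylvester (\<gamma> t) (\<gamma>' t) = G ** Q"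
      by (rule sylvester_unique[OF inj_lyapunov[OF SPD[OF t]]])
    \<comment> \<open>Q cancels one factor P on each side, leaving a quantity independent of t; its
      double is the acceleration.\<close>
    moreover have "G ** Q ** \<gamma> t ** (G ** Q) = G ** A ** G"
      by (metis K2 PG Q(1) matrix_mul_assoc matrix_mul_rid QG)
    ultimately show ?thesis
      by (simp add: wasserstein_christoffel_def \<gamma>''_def scaleR_2)
  qed
  have "geodesic_on Sym SPD wasserstein {-\<epsilon><..<\<epsilon>} \<gamma>"
    unfolding geodesic_on_def
    using SPD geodesic deriv deriv' levi_civita_form_wasserstein
    by (intro conjI exI[of _ wasserstein_christoffel] exI[of _ \<gamma>'] exI[of _ "\<lambda>_. \<gamma>''"]) auto
  moreover have "\<gamma> 0 = A"
    by (simp add: \<gamma>)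
  moreover have "(\<gamma> has_vector_derivative X) (at 0)"
    using deriv[of 0] by (simp add: \<gamma>'_def)
  ultimately show ?thesis
    using \<open>\<epsilon> > 0\<close> by blast
qed

end
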